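(* Consider the algorithm iSCRA-TL1 (described in the context), with $\overline k$ its total number of iterations. Suppose that $\sigma_A(r)>0$, $\mu\ge\|\overline x\|_\infty+\|(A_{\overline S}^\top A_{\overline S})^{-1}A_{\overline S}^\top e\|_\infty$, and $\lambda>\frac1m\big\|A_{\overline S^c}^\top\big(E-A_{\overline S}(A_{\overline S}^\top A_{\overline S})^{-1}A_{\overline S}^\top\big)e\big\|_\infty$. If $T^{\overline k-1}=\overline S^c$ and $x^{\overline k}$ is generated with error vector $\xi^{\overline k-1}=0$, then $x^{\overline k}$ is the unique optimal solution of $\min_{{\rm supp}(x)\subset\overline S}\|Ax-b\|^2$ and is a local optimal solution of the problem $$\min_{x\in\mathbb{R}^n}\ \frac{1}{2m}\|Ax-b\|^2+\lambda\|x\|_0.$$ If in addition $\min_{i\in\overline S}|\overline x_i|>\|(A_{\overline S}^\top A_{\overline S})^{-1}A_{\overline S}^\top e\|_\infty$, then ${\rm sign}(x^{\overline k})={\rm sign}(\overline x)$.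
   Context: **Setting.** $A\in\mathbb{R}^{m\times n}$ with $m<n$, $e\in\mathbb{R}^m$, $\overline x\in\mathbb{R}^n$ has exactly $r$ nonzero entries with $2\le r<n$ ($r\ll n$), $b:=A\overline x+e$, $\overline S:={\rm supp}(\overline x)$, $\lambda>0$. **Notation.** $J^c=[n]\setminus J$ with $[n]=\{1,\ldots,n\}$; $A_J$ is the submatrix of columns indexed by $J$, $x_J$ the subvector; $E$ is the identity; $\|\cdot\|$ is the $\ell_2$ norm; $\|x\|_0$ is the number of nonzero entries; ${\rm sign}(x)$ is the entrywise sign vector. $\sigma_A(l):=\min_{\|x\|_0\le l,\|x\|=1}\frac{1}{\sqrt m}\|Ax\|$. **Algorithm iSCRA-TL1.** Input: $\epsilon\ge0$, $\mu>0$, $\varrho\in(0,1]$, $T^0=[n]$, a nonincreasing $\{\varsigma_k\}_{k\ge0}\subset\mathbb{R}_+$ with $\varsigma_0<1$. For $k=1,2,\ldots$: 1) with some error vector $\xi^{k-1}\in\mathbb{R}^n$ satisfying $\|\xi^{k-1}\|_\infty\le\varsigma_{k-1}$, take any $x^k\in\arg\min_{x\in\mathbb{R}^n}\{\frac{1}{2m}\|Ax-b\|^2+\lambda\sum_{i\in T^{k-1}}|x_i|-\lambda\langle\xi^{k-1},x\rangle\ :\ \|x_{(T^{k-1})^c}\|_\infty\le\mu\}$; 2) if $\|x^k_{T^{k-1}}\|_\infty\le\epsilon$ or $T^{k-1}=\emptyset$, stop; 3) otherwise set $I^k:=\{i\in T^{k-1}:|x_i^k|\ge\varrho\|x^k_{T^{k-1}}\|_\infty\}$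 and $T^k:=T^{k-1}\setminus I^k$. $\overline k$ denotes the index of the iteration at which the algorithm stops. *)

theory Defs
  imports "HOL-Analysis.Analysis"
begin

definition supp :: "real^'n \<Rightarrow> 'n set" where
  "supp x = {i. x $ i \<noteq> 0}"

definition norm0 :: "real^'n \<Rightarrow> nat" where
  "norm0 x = card (supp x)"

text \<open>\<open>sgn\<close> on vectors is the normalised vector; this is the sign taken entry by entry.\<close>

definition sign_vec :: "real^'n \<Rightarrow> real^'n" where
  "sign_vec x = (\<chi> i. sgn (x $ i))"

text \<open>Subvectors and column submatrices keep their ambient index type and are padded with zeros
  outside \<open>J\<close>. Euclidean and maximum norms are unaffected by the padding (the maximum norm of an
  empty subvector is \<open>0\<close>).\<close>

definition sub_vec :: "'n set \<Rightarrow> real^'n \<Rightarrow> real^'n" where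
  "sub_vec J x = (\<chi> i. if i \<in> J then x $ i else 0)"

definition sub_cols :: "'n set \<Rightarrow> real^'n^'m \<Rightarrow> real^'n^'m" where
  "sub_cols J A = (\<chi> i j. if j \<in> J then A $ i $ j else 0)"

definition id_on :: "'n::finite set \<Rightarrow> real^'n^'n" where
  "id_on J = sub_cols J (mat 1)"

text \<open>Inverse of the \<open>J \<times> J\<close> block of a zero-padded matrix, again padded with zeros. It is
  determined only if that block is invertible; lemma \<open>inv_on_gram_reindex\<close> relates it to
  \<open>matrix_inv\<close> of the matrix actually indexed by \<open>J\<close>.\<close>

definition inv_on :: "'n::finite set \<Rightarrow> real^'n^'n \<Rightarrow> real^'n^'n" where
  "inv_on J M = (THE G. (\<forall>i j. i \<notin> J \<or> j \<notin> J \<longrightarrow> G $ i $ j = 0) \<and>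
                        M ** G = id_on J \<and> G ** M = id_on J)"

abbreviation gram_inv :: "'n::finite set \<Rightarrow> real^'n^'m \<Rightarrow> real^'n^'n" where
  "gram_inv J A \<equiv> inv_on J (transpose (sub_cols J A) ** sub_cols J A)"

text \<open>For \<open>l \<ge> 1\<close> the infimum is attained, the feasible set being nonempty and compact.\<close>

definition sigma :: "real^'n^'m \<Rightarrow> nat \<Rightarrow> real" where
  "sigma A l = (INF x\<in>{x. norm0 x \<le> l \<and> norm x = 1}. 1 / sqrt (real CARD('m)) * norm (A *v x))"

definition is_local_min :: "('a::topological_space \<Rightarrow> real) \<Rightarrow> 'a \<Rightarrow> bool" where
  "is_local_min f x \<longleftrightarrow> (\<forall>\<^sub>F z in nhds x. f x \<le> f z)"

definition tl1_objective ::
  "real^'n^'m \<Rightarrow> real^'m \<Rightarrow> real \<Rightarrow> 'n set \<Rightarrow> real^'n \<Rightarrow> real^'n \<Rightarrow> real" where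
  "tl1_objective A b lam T \<xi> z =
     1 / (2 * real CARD('m)) * (norm (A *v z - b))\<^sup>2 + lam * (\<Sum>i\<in>T. \<bar>z $ i\<bar>) - lam * (\<xi> \<bullet> z)"

definition l0_objective :: "real^'n^'m \<Rightarrow> real^'m \<Rightarrow> real \<Rightarrow> real^'n \<Rightarrow> real" where
  "l0_objective A b lam z =
     1 / (2 * real CARD('m)) * (norm (A *v z - b))\<^sup>2 + lam * real (norm0 z)"

definition iSCRA_stop :: "real \<Rightarrow> 'n set \<Rightarrow> real^'n \<Rightarrow> bool" where
  "iSCRA_stop \<epsilon> T x \<longleftrightarrow> infnorm (sub_vec T x) \<le> \<epsilon> \<or> T = {}"

definition iSCRA_select :: "real \<Rightarrow> 'n set \<Rightarrow> real^'n \<Rightarrow> 'n set" where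
  "iSCRA_select \<rho> T x = {i \<in> T. \<bar>x $ i\<bar> \<ge> \<rho> * infnorm (sub_vec T x)}"

text \<open>The sequences \<open>\<xi>\<close>, \<open>x\<close>, \<open>T\<close> record a run that stops exactly at iteration \<open>kbar\<close>.
  Only \<open>\<xi> 0, \<dots>, \<xi> (kbar - 1)\<close>, \<open>x 1, \<dots>, x kbar\<close> and \<open>T 0, \<dots>, T (kbar - 1)\<close> matter;
  the error vectors and the choice among minimisers are arbitrary.\<close>

definition iSCRA_TL1_run ::
  "real^'n^'m \<Rightarrow> real^'m \<Rightarrow> real \<Rightarrow> real \<Rightarrow> real \<Rightarrow> real \<Rightarrow> (nat \<Rightarrow> real) \<Rightarrow>
   (nat \<Rightarrow> real^'n) \<Rightarrow> (nat \<Rightarrow> real^'n) \<Rightarrow> (nat \<Rightarrow> 'n set) \<Rightarrow> nat \<Rightarrow> bool" where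
  "iSCRA_TL1_run A b lam \<epsilon> \<mu> \<rho> \<tau> \<xi> x T kbar \<longleftrightarrow>
     1 \<le> kbar \<and> T 0 = UNIV \<and>
     (\<forall>k\<in>{1..kbar}.
        infnorm (\<xi> (k - 1)) \<le> \<tau> (k - 1) \<and>
        is_arg_min (tl1_objective A b lam (T (k - 1)) (\<xi> (k - 1)))
                   (\<lambda>z. infnorm (sub_vec (- T (k - 1)) z) \<le> \<mu>) (x k)) \<and>
     (\<forall>k\<in>{1..<kbar}.
        \<not> iSCRA_stop \<epsilon> (T (k - 1)) (x k) \<and>
        T k = T (k - 1) - iSCRA_select \<rho> (T (k - 1)) (x k)) \<and>
     iSCRA_stop \<epsilon> (T (kbar - 1)) (x kbar)"

lemma sub_cols_eq: "sub_cols J A = A ** id_on J"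
  by (simp add: vec_eq_iff sub_cols_def id_on_def matrix_matrix_mult_def mat_def
      if_distrib[where f="\<lambda>t. _ * t"] cong: if_cong)

lemma transpose_id_on: "transpose (id_on J) = id_on J"
  by (auto simp: vec_eq_iff transpose_def id_on_def sub_cols_def mat_def)

lemma padded_iff:
  fixes G :: "real^'n^'n"
  shows "(\<forall>i j. i \<notin> J \<or> j \<notin> J \<longrightarrow> G $ i $ j = 0) \<longleftrightarrow> id_on J ** G = G \<and> G ** id_on J = G"
proof -
  have r: "G ** id_on J = G \<longleftrightarrow> (\<forall>i j. j \<notin> J \<longrightarrow> G $ i $ j = 0)" for G :: "real^'n^'n"
    by (auto simp: sub_cols_eq[symmetric] sub_cols_def vec_eq_iff)
  have "id_on J ** G = G \<longleftrightarrow> transpose G ** id_on J = transpose G"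
    by (metis matrix_transpose_mul transpose_id_on transpose_transpose)
  also have "\<dots> \<longleftrightarrow> (\<forall>i j. i \<notin> J \<longrightarrow> G $ i $ j = 0)"
    unfolding r by (auto simp: transpose_def)
  finally show ?thesis
    using r[of G] by blast
qed

lemma inv_on_eqI:
  assumes "\<forall>i j. i \<notin> J \<or> j \<notin> J \<longrightarrow> G $ i $ j = 0"
    and "M ** G = id_on J" "G ** M = id_on J"
  shows "inv_on J M = G"
  unfolding inv_on_def
proof (rule the_equality)
  fix H
  assume H: "(\<forall>i j. i \<notin> J \<or> j \<notin> J \<longrightarrow> H $ i $ j = 0) \<and> M ** H = id_on J \<and> H ** M = id_on J"
  have "H = H ** (M ** G)"
    using H assms(2) padded_iff[of J H] by simp
  also have "\<dots> = id_on J ** G"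
    using H by (simp add: matrix_mul_assoc)
  also have "\<dots> = G"
    using assms(1) padded_iff[of J G] by simp
  finally show "H = G" .
qed (use assms in blast)

lemma inv_on_gram_reindex:
  fixes A :: "real^'n^'m" and f :: "'k::finite \<Rightarrow> 'n"
  defines "B \<equiv> (\<chi> i a. A $ i $ f a) :: real^'k^'m"
  assumes f: "inj f" "range f = J" and inv: "invertible (transpose B ** B)"
  shows "gram_inv J A $ f a $ f c = matrix_inv (transpose B ** B) $ a $ c"
proof -
  define P :: "real^'k^'n" where "P = (\<chi> i a. if f a = i then 1 else 0)"
  define N where "N = transpose B ** B"
  define G where "G = P ** matrix_inv N ** transpose P"
  have PP: "transpose P ** P = mat 1"
    using f(1) by (auto simp: vec_eq_iff P_def transpose_def matrix_matrix_mult_def mat_def inj_eq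
        if_distrib[where f="\<lambda>t. _ * t"] if_distrib[where f="\<lambda>t. t * _"] cong: if_cong)
  have PP': "P ** transpose P = id_on J"
  proof -
    have "(\<Sum>a\<in>UNIV. (if f a = i then 1 else 0) * (if f a = j then 1 else 0))
        = (if j \<in> J then if i = j then 1 else 0 else (0::real))" for i j
    proof -
      have "(\<Sum>a\<in>UNIV. (if f a = i then 1 else 0) * (if f a = j then 1 else 0))
          = (\<Sum>x\<in>range f. (if x = i then 1 else 0) * (if x = j then 1 else (0::real)))"
        using f(1) by (simp add: sum.reindex)
      also have "\<dots> = (if j \<in> J then if i = j then 1 else 0 else 0)"
        using f(2) by (auto simp: if_distrib[where f="\<lambda>t. _ * t"] cong: if_cong)
      finally show ?thesis .
    qed
    then show ?thesis
      by (simp add: vec_eq_iff P_def transpose_def matrix_matrix_mult_def id_on_def sub_cols_def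
          mat_def)
  qed
  have B: "B = A ** P"
    by (simp add: vec_eq_iff B_def P_def matrix_matrix_mult_def
        if_distrib[where f="\<lambda>t. _ * t"] cong: if_cong)
  have M: "transpose (sub_cols J A) ** sub_cols J A = P ** N ** transpose P" (is "?M = _")
    by (simp add: sub_cols_eq PP'[symmetric] N_def B matrix_transpose_mul matrix_mul_assoc)
  have N: "N ** matrix_inv N = mat 1" "matrix_inv N ** N = mat 1"
    using someI_ex[OF inv[unfolded invertible_def]] by (simp_all add: N_def matrix_inv_def)
  have mid: "P ** X ** transpose P ** (P ** Y ** transpose P) = P ** (X ** Y) ** transpose P"
    for X Y :: "real^'k^'k"
    by (metis PP matrix_mul_assoc matrix_mul_rid)
  have "?M ** G = id_on J" "G ** ?M = id_on J"
    by (simp_all add: M G_def mid N PP')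
  moreover have "id_on J ** G = G" "G ** id_on J = G"
    unfolding G_def PP'[symmetric] by (metis PP matrix_mul_assoc matrix_mul_lid)+
  ultimately have "inv_on J ?M = G"
    by (intro inv_on_eqI iffD2[OF padded_iff] conjI)
  moreover have "G $ f a $ f c = matrix_inv N $ a $ c"
  proof -
    have "transpose P ** G ** P = matrix_inv N"
      unfolding G_def by (metis PP matrix_mul_assoc matrix_mul_lid matrix_mul_rid)
    moreover have "(transpose P ** G ** P) $ a $ c = G $ f a $ f c"
      by (simp add: P_def transpose_def matrix_matrix_mult_def
          if_distrib[where f="\<lambda>t. _ * t"] if_distrib[where f="\<lambda>t. t * _"] cong: if_cong)
    ultimately show ?thesis by simp
  qed
  ultimately show ?thesis by (simp add: N_def)
qed

end

theory Submission
  imports Defs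
begin

text \<open>
  The least squares solution over the vectors supported in \<open>S\<close> can be written down: it is
  \<open>w = xbar + d\<close> with \<open>d = gram_inv S A (A\<^sub>S\<^sup>T e)\<close>, and its residual \<open>q = b - A w\<close> is the
  projection of the noise \<open>e\<close> onto the orthogonal complement of the range of \<open>A\<^sub>S\<close>. Everything
  follows from four facts about this one point: \<open>w\<close> vanishes off \<open>S\<close>; the correlations \<open>A\<^sup>T q\<close>
  vanish on \<open>S\<close>; the hypothesis on \<open>lam\<close> says that off \<open>S\<close> they are smaller than \<open>m lam\<close>, where
  \<open>m = CARD('m)\<close>; and \<open>sigma A r > 0\<close> says that \<open>A\<close> is injective on vectors supported in \<open>S\<close>.

  Expanding the square around \<open>w\<close> gives
  \<open>\<parallel>A z - b\<parallel>\<^sup>2 = \<parallel>A (z - w)\<parallel>\<^sup>2 - 2 \<langle>z - w, A\<^sup>T q\<rangle> + \<parallel>q\<parallel>\<^sup>2\<close>, and the inner product only sees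
  coordinates off \<open>S\<close>. Three consequences:

  \<^item> For \<open>z\<close> supported in \<open>S\<close> the inner product is \<open>0\<close>, so \<open>w\<close> is the unique minimiser of the
    least squares problem over \<open>S\<close> (\<open>unique_restricted_least_squares\<close>).

  \<^item> In the subproblem solved last, the penalty \<open>lam \<Sum>\<^bsub>i\<notin>S\<^esub> \<bar>z\<^sub>i\<bar>\<close> dominates the inner product
    divided by \<open>m\<close>, strictly once \<open>z\<close> has a nonzero entry off \<open>S\<close>. Together with injectivity, every
    \<open>z \<noteq> w\<close> has a larger objective (\<open>unique_partial_l1_minimiser\<close>). The bound on \<open>\<mu>\<close> makes \<open>w\<close>
    feasible, hence the last iterate is \<open>w\<close>.

  \<^item> Close to \<open>w\<close> no entry of the support of \<open>w\<close> can vanish. A nearby \<open>z\<close> supported in \<open>S\<close>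
    therefore improves neither term of the \<open>\<ell>\<^sub>0\<close> objective, and any other nearby \<open>z\<close> pays at least
    \<open>lam\<close> for an additional nonzero entry, more than the continuous quadratic term can return
    (\<open>restricted_least_squares_local_min\<close>).

  For the signs, \<open>w\<close> differs from \<open>xbar\<close> by \<open>d\<close> alone, and a \<open>d\<close> smaller in maximum norm than every
  nonzero entry of \<open>xbar\<close> cannot flip or annihilate one.
\<close>

section \<open>Padded subvectors and column submatrices\<close>

lemma id_on_mult_vec: "id_on J *v z = sub_vec J z"
proof -
  have "id_on J $ i $ j * z $ j = (if j = i then sub_vec J z $ i else 0)" for i j
    by (simp add: id_on_def sub_cols_def mat_def sub_vec_def)
  then show ?thesis
    by (simp add: vec_eq_iff matrix_vector_mult_def)
qed

lemma id_on_idem: "id_on J ** id_on J = id_on J"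
  by (simp add: sub_cols_eq[symmetric]) (simp add: id_on_def sub_cols_def vec_eq_iff)

lemma sub_vec_supp_subset: "supp z \<subseteq> J \<Longrightarrow> sub_vec J z = z"
  by (auto simp: vec_eq_iff sub_vec_def supp_def)

lemma supp_sub_vec_subset: "supp (sub_vec J z) \<subseteq> J"
  by (auto simp: sub_vec_def supp_def)

lemma supp_add_subset: "supp x \<subseteq> J \<Longrightarrow> supp y \<subseteq> J \<Longrightarrow> supp (x + y) \<subseteq> J"
  by (fastforce simp: supp_def)

lemma supp_diff_subset: "supp x \<subseteq> J \<Longrightarrow> supp y \<subseteq> J \<Longrightarrow> supp (x - y) \<subseteq> J"
  by (fastforce simp: supp_def)

lemma transpose_sub_cols_mult_vec:
  "transpose (sub_cols J A) *v v = sub_vec J (transpose A *v v)"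
  by (simp add: sub_cols_eq matrix_transpose_mul transpose_id_on
      matrix_vector_mul_assoc[symmetric] id_on_mult_vec)

lemma inner_mult_vec: "(A *v x) \<bullet> y = x \<bullet> (transpose A *v y)"
  for A :: "real^'n^'m"
  by (metis dot_lmul_matrix inner_commute transpose_matrix_vector)

lemma infnorm_le_component_bound:
  fixes z :: "real^'n"
  assumes "\<And>i. \<bar>z $ i\<bar> \<le> c"
  shows "infnorm z \<le> c"
  unfolding infnorm_cart by (rule cSup_least) (use assms in auto)

lemma infnorm_sub_vec_le: "infnorm (sub_vec J z) \<le> infnorm z"
  by (rule infnorm_le_component_bound)
    (simp add: sub_vec_def component_le_infnorm_cart infnorm_pos_le)

section \<open>Injectivity on a support and the inverse of the Gram matrix\<close>

text \<open>A nonzero kernel vector with at most \<open>l\<close> nonzero entries would, once normalised, be a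
  competitor with value \<open>0\<close> in the infimum defining \<open>sigma A l\<close>.\<close>

lemma sigma_pos_imp_kernel_trivial:
  fixes A :: "real^'n^'m"
  assumes pos: "sigma A l > 0" and sparse: "norm0 z \<le> l" and ker: "A *v z = 0"
  shows "z = 0"
proof (rule ccontr)
  assume nz: "z \<noteq> 0"
  define u where "u = (1 / norm z) *\<^sub>R z"
  have "supp u = supp z"
    using nz by (auto simp: supp_def u_def)
  moreover have "norm u = 1"
    using nz by (simp add: u_def)
  ultimately have u: "u \<in> {x. norm0 x \<le> l \<and> norm x = 1}"
    using sparse by (simp add: norm0_def)
  have "sigma A l \<le> 1 / sqrt (real CARD('m)) * norm (A *v u)"
    unfolding sigma_def by (rule cINF_lower[OF _ u]) (auto intro!: bdd_belowI2[of _ 0])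
  also have "A *v u = 0"
    by (simp add: u_def matrix_vector_mult_scaleR ker)
  finally show False
    using pos by simp
qed

text \<open>Adding the identity on the complementary block to the padded Gram matrix gives a positive
  definite, hence invertible, matrix of full size. It commutes with the coordinate projection onto
  \<open>J\<close>, so its ordinary inverse, cut down to the block, inverts the Gram matrix there. This is what
  gives the definite description in \<open>inv_on\<close> a value.\<close>

lemma gram_inv_properties:
  fixes A :: "real^'n^'m"
  assumes inj: "\<And>z. supp z \<subseteq> J \<Longrightarrow> A *v z = 0 \<Longrightarrow> z = 0"
  defines "M \<equiv> transpose (sub_cols J A) ** sub_cols J A"
  shows "M ** gram_inv J A = id_on J" "id_on J ** gram_inv J A = gram_inv J A"
proof -
  let ?P = "id_on J" and ?Q = "id_on (- J)"
  define K where "K = M + ?Q"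
  have PQ: "?P ** ?Q = 0" "?Q ** ?P = 0"
    by (auto simp: vec_eq_iff id_on_def sub_cols_def matrix_matrix_mult_def mat_def
        if_distrib[where f="\<lambda>t. _ * t"] if_distrib[where f="\<lambda>t. t * _"] cong: if_cong)
  have M: "M = ?P ** (transpose A ** A) ** ?P"
    by (simp add: M_def sub_cols_eq matrix_transpose_mul transpose_id_on matrix_mul_assoc)
  have PM: "?P ** M = M" "M ** ?P = M"
    by (simp add: M matrix_mul_assoc id_on_idem)
      (simp add: M matrix_mul_assoc[symmetric] id_on_idem)
  have "(M + ?Q) ** ?P = M ** ?P + ?Q ** ?P"
    by (simp add: vec_eq_iff matrix_matrix_mult_def distrib_right sum.distrib)
  then have KP: "K ** ?P = M" "?P ** K = M"
    by (simp_all add: K_def matrix_add_ldistrib PM PQ)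
  have "z = 0" if z: "K *v z = 0" for z
  proof -
    have "0 = z \<bullet> (K *v z)"
      using z by simp
    also have "\<dots> = (sub_cols J A *v z) \<bullet> (sub_cols J A *v z) + z \<bullet> sub_vec (- J) z"
      by (simp add: K_def M_def matrix_vector_mult_add_rdistrib inner_add_right inner_mult_vec
          matrix_vector_mul_assoc[symmetric] id_on_mult_vec)
    also have "z \<bullet> sub_vec (- J) z = sub_vec (- J) z \<bullet> sub_vec (- J) z"
      by (auto simp: inner_vec_def sub_vec_def intro!: sum.cong)
    finally have "(norm (sub_cols J A *v z))\<^sup>2 + (norm (sub_vec (- J) z))\<^sup>2 = 0"
      by (simp add: power2_norm_eq_inner)
    then have "sub_cols J A *v z = 0" "sub_vec (- J) z = 0"
      by simp_all
    then have "A *v sub_vec J z = 0" and supp: "supp z \<subseteq> J"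
      by (simp_all add: sub_cols_eq matrix_vector_mul_assoc[symmetric] id_on_mult_vec)
        (auto simp: supp_def vec_eq_iff sub_vec_def split: if_splits)
    then show ?thesis
      using inj by (simp add: sub_vec_supp_subset)
  qed
  then obtain N where NK: "N ** K = mat 1"
    using matrix_left_invertible_ker by blast
  then have KN: "K ** N = mat 1"
    by (simp add: matrix_left_right_inverse)
  have "?P ** N = N ** (K ** ?P) ** N"
    by (simp add: matrix_mul_assoc NK)
  also have "\<dots> = N ** (?P ** K) ** N"
    by (simp only: KP)
  also have "\<dots> = N ** ?P ** (K ** N)"
    by (simp only: matrix_mul_assoc)
  finally have comm: "?P ** N = N ** ?P"
    by (simp add: KN)
  let ?G = "?P ** N"
  have G: "?P ** ?G = ?G"
    by (simp add: matrix_mul_assoc id_on_idem)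
  have G': "?G ** ?P = ?G"
    by (simp add: comm matrix_mul_assoc[symmetric] id_on_idem)
  have "M ** ?G = ?P ** (K ** N)"
    by (simp add: matrix_mul_assoc PM KP)
  then have MG: "M ** ?G = ?P"
    by (simp add: KN)
  have "?G ** M = N ** (K ** ?P)"
    by (simp add: comm matrix_mul_assoc[symmetric] PM KP)
  then have GM: "?G ** M = ?P"
    by (simp add: matrix_mul_assoc NK)
  have "gram_inv J A = ?G"
    using inv_on_eqI[OF iffD2[OF padded_iff] MG GM] G G' by (simp add: M_def)
  then show "M ** gram_inv J A = ?P" "?P ** gram_inv J A = gram_inv J A"
    using MG G by simp_all
qed

section \<open>Consequences of the optimality conditions\<close>

lemma residual_norm_expand:
  fixes A :: "real^'n^'m"
  shows "(norm (A *v z - b))\<^sup>2 = (norm (A *v (z - w)))\<^sup>2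
    - 2 * ((z - w) \<bullet> (transpose A *v (b - A *v w))) + (norm (b - A *v w))\<^sup>2"
proof -
  have "A *v z - b = A *v (z - w) - (b - A *v w)"
    by (simp add: matrix_vector_mult_diff_distrib)
  then show ?thesis
    by (simp only: power2_norm_eq_inner inner_mult_vec[symmetric] inner_diff_left
        inner_diff_right) (simp add: inner_commute)
qed

text \<open>Pythagoras: within the support the residual at \<open>w\<close> is orthogonal to all changes of fit.\<close>

lemma residual_norm_expand_on_support:
  fixes A :: "real^'n^'m"
  assumes w: "supp w \<subseteq> S" and z: "supp z \<subseteq> S"
    and orth: "sub_vec S (transpose A *v (b - A *v w)) = 0"
  shows "(norm (A *v z - b))\<^sup>2 = (norm (A *v (z - w)))\<^sup>2 + (norm (A *v w - b))\<^sup>2"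
proof -
  have "(z - w) $ i * (transpose A *v (b - A *v w)) $ i = 0" for i
    using supp_diff_subset[OF z w] orth
    by (cases "i \<in> S") (auto simp: supp_def vec_eq_iff sub_vec_def split: if_splits)
  then have "(z - w) \<bullet> (transpose A *v (b - A *v w)) = 0"
    unfolding inner_vec_def by (simp only: inner_real_def sum.neutral_const)
  then show ?thesis
    using residual_norm_expand[of A z b w] norm_minus_commute[of b "A *v w"] by simp
qed

lemma unique_restricted_least_squares:
  fixes A :: "real^'n^'m"
  assumes w: "supp w \<subseteq> S"
    and orth: "sub_vec S (transpose A *v (b - A *v w)) = 0"
    and inj: "\<And>z. supp z \<subseteq> S \<Longrightarrow> A *v z = 0 \<Longrightarrow> z = 0"
  shows "is_arg_min (\<lambda>z. (norm (A *v z - b))\<^sup>2) (\<lambda>z. supp z \<subseteq> S) y \<longleftrightarrow> y = w"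
proof
  assume y: "is_arg_min (\<lambda>z. (norm (A *v z - b))\<^sup>2) (\<lambda>z. supp z \<subseteq> S) y"
  then have supp: "supp y \<subseteq> S" and "(norm (A *v y - b))\<^sup>2 \<le> (norm (A *v w - b))\<^sup>2"
    using w by (auto simp: is_arg_min_linorder)
  then have "A *v (y - w) = 0"
    using residual_norm_expand_on_support[OF w supp orth] by simp
  then show "y = w"
    using inj[OF supp_diff_subset[OF supp w]] by simp
next
  assume "y = w"
  then show "is_arg_min (\<lambda>z. (norm (A *v z - b))\<^sup>2) (\<lambda>z. supp z \<subseteq> S) y"
    unfolding is_arg_min_linorder
    using w residual_norm_expand_on_support[OF w _ orth] by (metis le_add_same_cancel2 zero_le_power2)
qed

text \<open>The gap between the objective at \<open>z\<close> and at \<open>w\<close> is \<open>\<parallel>A (z - w)\<parallel>\<^sup>2 / 2m\<close> plus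
  \<open>lam \<bar>z\<^sub>i\<bar> - z\<^sub>i (A\<^sup>T q)\<^sub>i / m\<close> summed over \<open>i \<notin> S\<close>. The strict bound on the correlations
  makes each summand positive unless \<open>z\<^sub>i = 0\<close>, so a vanishing gap first confines \<open>z\<close> to \<open>S\<close>, and
  then injectivity yields \<open>z = w\<close>.\<close>

lemma unique_partial_l1_minimiser:
  fixes A :: "real^'n^'m"
  assumes w: "supp w \<subseteq> S"
    and orth: "sub_vec S (transpose A *v (b - A *v w)) = 0"
    and dual: "\<And>i. i \<notin> S \<Longrightarrow> \<bar>(transpose A *v (b - A *v w)) $ i\<bar> < real CARD('m) * lam"
    and inj: "\<And>z. supp z \<subseteq> S \<Longrightarrow> A *v z = 0 \<Longrightarrow> z = 0"
    and le: "tl1_objective A b lam (- S) 0 z \<le> tl1_objective A b lam (- S) 0 w"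
  shows "z = w"
proof -
  let ?m = "real CARD('m)"
  define g where "g = transpose A *v (b - A *v w)"
  define t where "t i = lam * \<bar>z $ i\<bar> - z $ i * g $ i / ?m" for i
  have m: "?m > 0"
    by simp
  have w0: "w $ i = 0" if "i \<notin> S" for i
    using w that by (auto simp: supp_def)
  have g0: "g $ i = 0" if "i \<in> S" for i
  proof -
    have "g $ i = sub_vec S g $ i"
      using that by (simp add: sub_vec_def)
    then show ?thesis
      by (simp only: g_def orth zero_index)
  qed
  have t_pos: "t i > 0" if i: "i \<in> - S" and nz: "z $ i \<noteq> 0" for i
  proof -
    have "z $ i * g $ i \<le> \<bar>z $ i\<bar> * \<bar>g $ i\<bar>"
      by (metis abs_ge_self abs_mult)
    also have "\<dots> < \<bar>z $ i\<bar> * (?m * lam)"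
      using dual[of i] i nz by (intro mult_strict_left_mono) (auto simp: g_def)
    finally show ?thesis
      using m by (simp add: t_def field_simps)
  qed
  then have t_nonneg: "t i \<ge> 0" if "i \<in> - S" for i
    using that by (cases "z $ i = 0") (auto simp: t_def less_imp_le)
  have "(z - w) \<bullet> g = (\<Sum>i\<in>UNIV. (z - w) $ i * g $ i)"
    by (simp add: inner_vec_def)
  also have "\<dots> = (\<Sum>i\<in>- S. z $ i * g $ i)"
    by (rule sum.mono_neutral_cong_right) (auto simp: g0 w0)
  finally have inner: "(z - w) \<bullet> g = (\<Sum>i\<in>- S. z $ i * g $ i)" .
  have wsum: "(\<Sum>i\<in>- S. \<bar>w $ i\<bar>) = 0"
    by (simp add: w0)
  have tsum: "(\<Sum>i\<in>- S. t i) = lam * (\<Sum>i\<in>- S. \<bar>z $ i\<bar>) - (\<Sum>i\<in>- S. z $ i * g $ i) / ?m"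
    by (simp add: t_def sum_subtractf sum_distrib_left sum_divide_distrib)
  have "tl1_objective A b lam (- S) 0 z - tl1_objective A b lam (- S) 0 w
      = 1 / (2 * ?m) * (norm (A *v (z - w)))\<^sup>2 + (\<Sum>i\<in>- S. t i)"
    unfolding tl1_objective_def residual_norm_expand[of A z b w] wsum tsum
      g_def[symmetric] inner
    by (simp add: norm_minus_commute[of b] field_simps)
  then have gap: "1 / (2 * ?m) * (norm (A *v (z - w)))\<^sup>2 + (\<Sum>i\<in>- S. t i) \<le> 0"
    using le by linarith
  have sq: "1 / (2 * ?m) * (norm (A *v (z - w)))\<^sup>2 \<ge> 0"
    by simp
  have tge: "(\<Sum>i\<in>- S. t i) \<ge> 0"
    by (rule sum_nonneg) (rule t_nonneg)
  have "(\<Sum>i\<in>- S. t i) = 0" "1 / (2 * ?m) * (norm (A *v (z - w)))\<^sup>2 = 0"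
    using gap sq tge by linarith+
  then have t0: "\<forall>i\<in>- S. t i = 0" and A0: "A *v (z - w) = 0"
    using sum_nonneg_eq_0_iff[of "- S" t] t_nonneg by (simp_all del: Compl_iff)
  have "supp z \<subseteq> S"
    using t0 t_pos by (force simp: supp_def)
  then show ?thesis
    using inj[OF supp_diff_subset[OF _ w] A0] by simp
qed

lemma eventually_supp_superset: "\<forall>\<^sub>F z in nhds w. supp w \<subseteq> supp z"
  for w :: "real^'n"
proof -
  have "\<forall>\<^sub>F z in nhds w. z $ i \<noteq> 0" if "i \<in> supp w" for i
  proof -
    have "((\<lambda>z. z $ i) \<longlongrightarrow> w $ i) (nhds w)"
      by (intro tendsto_vec_nth filterlim_ident)
    then show ?thesis
      using that by (intro tendsto_imp_eventually_ne) (auto simp: supp_def)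
  qed
  then have "\<forall>\<^sub>F z in nhds w. \<forall>i\<in>supp w. z $ i \<noteq> 0"
    by (simp add: eventually_ball_finite)
  then show ?thesis
    by eventually_elim (auto simp: supp_def)
qed

text \<open>Nearby points keep the support of \<open>w\<close>. Those that stay within \<open>S\<close> cannot fit better, and
  leaving \<open>S\<close> costs one full unit of the \<open>\<ell>\<^sub>0\<close> term, which by continuity outweighs any gain in
  fit.\<close>

lemma restricted_least_squares_local_min:
  fixes A :: "real^'n^'m"
  assumes w: "supp w \<subseteq> S"
    and opt: "\<And>z. supp z \<subseteq> S \<Longrightarrow> (norm (A *v w - b))\<^sup>2 \<le> (norm (A *v z - b))\<^sup>2"
    and lam: "lam > 0"
  shows "is_local_min (l0_objective A b lam) w"
proof -
  define f where "f z = 1 / (2 * real CARD('m)) * (norm (A *v z - b))\<^sup>2" for z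
  have "(f \<longlongrightarrow> f w) (nhds w)"
    unfolding f_def
    by (intro tendsto_intros filterlim_ident
        bounded_linear.tendsto[OF matrix_vector_mul_bounded_linear])
  then have close: "\<forall>\<^sub>F z in nhds w. f w - lam < f z"
    using lam by (intro order_tendstoD(1)) auto
  have "\<forall>\<^sub>F z in nhds w. f w + lam * real (norm0 w) \<le> f z + lam * real (norm0 z)"
    using close eventually_supp_superset[of w]
  proof eventually_elim
    case (elim z)
    show ?case
    proof (cases "supp z \<subseteq> S")
      case True
      then have "f w \<le> f z"
        using opt by (simp add: f_def divide_right_mono)
      moreover have "norm0 w \<le> norm0 z"
        using elim(2) by (simp add: norm0_def card_mono)
      ultimately show ?thesis
        using lam by (intro add_mono mult_left_mono) auto
    next
      case False
      then have "norm0 w < norm0 z"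
        unfolding norm0_def using elim(2) w by (intro psubset_card_mono) auto
      then have "lam * (real (norm0 w) + 1) \<le> lam * real (norm0 z)"
        using lam by (intro mult_left_mono) auto
      then show ?thesis
        using elim(1) by (simp add: algebra_simps)
    qed
  qed
  then show ?thesis
    by (simp add: is_local_min_def l0_objective_def f_def)
qed

section \<open>Optimality of the last iterate\<close>

theorem theorem21:
  fixes A :: "real^'n^'m" and b e :: "real^'m" and xbar :: "real^'n" and S :: "'n set"
    and r kbar :: nat and lam \<epsilon> \<mu> \<rho> :: real and \<tau> :: "nat \<Rightarrow> real"
    and \<xi> x :: "nat \<Rightarrow> real^'n" and T :: "nat \<Rightarrow> 'n set"
  assumes dims: "CARD('m) < CARD('n)"
    and r: "norm0 xbar = r" "2 \<le> r" "r < CARD('n)"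
    and b: "b = A *v xbar + e"
    and S: "S = supp xbar"
    and params: "lam > 0" "\<epsilon> \<ge> 0" "\<mu> > 0" "0 < \<rho>" "\<rho> \<le> 1"
    and tau: "decseq \<tau>" "\<And>k. \<tau> k \<ge> 0" "\<tau> 0 < 1"
    and run: "iSCRA_TL1_run A b lam \<epsilon> \<mu> \<rho> \<tau> \<xi> x T kbar"
    and sigma_pos: "sigma A r > 0"
    and mu: "\<mu> \<ge> infnorm xbar + infnorm (gram_inv S A *v (transpose (sub_cols S A) *v e))"
    and lam: "lam > 1 / real CARD('m) *
      infnorm (transpose (sub_cols (- S) A) *v
        ((mat 1 - sub_cols S A ** gram_inv S A ** transpose (sub_cols S A)) *v e))"
    and T_last: "T (kbar - 1) = - S"
    and xi_last: "\<xi> (kbar - 1) = 0"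
  shows "is_arg_min (\<lambda>z. (norm (A *v z - b))\<^sup>2) (\<lambda>z. supp z \<subseteq> S) (x kbar) \<and>
    (\<forall>y. is_arg_min (\<lambda>z. (norm (A *v z - b))\<^sup>2) (\<lambda>z. supp z \<subseteq> S) y \<longrightarrow> y = x kbar) \<and>
    is_local_min (l0_objective A b lam) (x kbar) \<and>
    (Min ((\<lambda>i. \<bar>xbar $ i\<bar>) ` S) > infnorm (gram_inv S A *v (transpose (sub_cols S A) *v e)) \<longrightarrow>
      sign_vec (x kbar) = sign_vec xbar)"
proof -
  note transpose_matrix_vector [simp del]
  let ?B = "sub_cols S A" and ?G = "gram_inv S A"
  define d where "d = ?G *v (transpose ?B *v e)"
  define w where "w = xbar + d"
  define q where "q = (mat 1 - ?B ** ?G ** transpose ?B) *v e"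
  have inj: "z = 0" if "supp z \<subseteq> S" "A *v z = 0" for z
  proof (rule sigma_pos_imp_kernel_trivial[OF sigma_pos _ that(2)])
    have "card (supp z) \<le> card S"
      using that(1) by (simp add: card_mono)
    then show "norm0 z \<le> r"
      using r(1) S by (simp add: norm0_def)
  qed
  have MG: "transpose ?B ** ?B ** ?G = id_on S" and PG: "id_on S ** ?G = ?G"
    using gram_inv_properties[of S A] inj by auto
  have "sub_vec S d = d"
    by (simp add: d_def id_on_mult_vec[symmetric] matrix_vector_mul_assoc matrix_mul_assoc PG)
  then have supp_d: "supp d \<subseteq> S"
    by (metis supp_sub_vec_subset)
  have supp_w: "supp w \<subseteq> S"
    unfolding w_def using supp_d by (intro supp_add_subset) (simp_all add: S)
  have Bd: "q = e - A *v d"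
  proof -
    have "?B ** ?G = A ** (id_on S ** ?G)"
      by (simp only: sub_cols_eq matrix_mul_assoc)
    then have "?B ** ?G = A ** ?G"
      by (simp only: PG)
    then show ?thesis
      by (simp add: q_def d_def matrix_vector_mult_diff_rdistrib matrix_vector_mul_assoc
          matrix_mul_assoc)
  qed
  have q: "b - A *v w = q"
    by (simp add: b w_def Bd matrix_vector_right_distrib)
  \<comment> \<open>The normal equations: \<open>q\<close> is orthogonal to every column of \<open>A\<close> indexed by \<open>S\<close>.\<close>
  have "transpose ?B *v q = transpose ?B *v e - transpose ?B ** ?B ** ?G *v (transpose ?B *v e)"
    by (simp add: q_def matrix_vector_mult_diff_rdistrib matrix_vector_mult_diff_distrib
        matrix_vector_mul_assoc matrix_mul_assoc)
  also have "\<dots> = 0"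
    by (simp add: MG id_on_mult_vec transpose_sub_cols_mult_vec sub_vec_supp_subset
        supp_sub_vec_subset)
  finally have orth: "sub_vec S (transpose A *v (b - A *v w)) = 0"
    by (simp add: q transpose_sub_cols_mult_vec)
  have dual: "\<bar>(transpose A *v (b - A *v w)) $ i\<bar> < real CARD('m) * lam" if "i \<notin> S" for i
  proof -
    have "\<bar>(transpose A *v q) $ i\<bar> = \<bar>(transpose (sub_cols (- S) A) *v q) $ i\<bar>"
      using that by (simp add: transpose_sub_cols_mult_vec sub_vec_def)
    also have "\<dots> \<le> infnorm (transpose (sub_cols (- S) A) *v q)"
      by (rule component_le_infnorm_cart)
    also have "\<dots> < real CARD('m) * lam"
      using lam by (simp add: q_def field_simps)
    finally show ?thesis
      by (simp add: q)
  qed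
  have feasible: "infnorm (sub_vec S w) \<le> \<mu>"
  proof -
    have "infnorm (sub_vec S w) \<le> infnorm xbar + infnorm d"
      using infnorm_sub_vec_le[of S w] infnorm_triangle[of xbar d] by (simp add: w_def)
    then show ?thesis
      using mu by (simp add: d_def)
  qed
  have xw: "x kbar = w"
  proof -
    have "is_arg_min (tl1_objective A b lam (- S) 0) (\<lambda>z. infnorm (sub_vec S z) \<le> \<mu>) (x kbar)"
    proof -
      have "1 \<le> kbar" and steps: "\<forall>k\<in>{1..kbar}.
        infnorm (\<xi> (k - 1)) \<le> \<tau> (k - 1) \<and>
        is_arg_min (tl1_objective A b lam (T (k - 1)) (\<xi> (k - 1)))
          (\<lambda>z. infnorm (sub_vec (- T (k - 1)) z) \<le> \<mu>) (x k)"
        using run unfolding iSCRA_TL1_run_def by blast+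
      then have "kbar \<in> {1..kbar}"
        by simp
      from bspec[OF steps this] show ?thesis
        unfolding T_last xi_last double_complement by (rule conjunct2)
    qed
    then have "tl1_objective A b lam (- S) 0 (x kbar) \<le> tl1_objective A b lam (- S) 0 w"
      using feasible by (simp add: is_arg_min_linorder)
    with dual inj show ?thesis
      by (intro unique_partial_l1_minimiser[OF supp_w orth]) auto
  qed
  have uniq: "is_arg_min (\<lambda>z. (norm (A *v z - b))\<^sup>2) (\<lambda>z. supp z \<subseteq> S) y \<longleftrightarrow> y = w" for y
    using inj by (intro unique_restricted_least_squares[OF supp_w orth]) auto
  have locmin: "is_local_min (l0_objective A b lam) w"
    using uniq[of w] by (intro restricted_least_squares_local_min[OF supp_w _ params(1)])
      (auto simp: is_arg_min_linorder)
  have signs: "sign_vec w = sign_vec xbar" if big: "Min ((\<lambda>i. \<bar>xbar $ i\<bar>) ` S) > infnorm d"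
  proof -
    have "sgn (w $ i) = sgn (xbar $ i)" for i
    proof (cases "i \<in> S")
      case True
      then have "Min ((\<lambda>i. \<bar>xbar $ i\<bar>) ` S) \<le> \<bar>xbar $ i\<bar>"
        by (intro Min_le) auto
      then have "\<bar>d $ i\<bar> < \<bar>xbar $ i\<bar>"
        using big component_le_infnorm_cart[of d i] by linarith
      then show ?thesis
        by (auto simp: w_def sgn_real_def)
    next
      case False
      then have "w $ i = 0" "xbar $ i = 0"
        using supp_w S unfolding supp_def by blast+
      then show ?thesis
        by simp
    qed
    then show ?thesis
      by (simp add: sign_vec_def)
  qed
  show ?thesis
    unfolding xw uniq using locmin signs by (simp add: d_def)
qed

end
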